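(* Let $a>0$, $n\ge 1$, and let $K$ be the Kasteleyn matrix of the Aztec diamond graph of order $n$ (with white vertices $\mathtt W$, black vertices $\mathtt B$, as defined in the context). For $x=(x_1,x_2)\in\mathtt W$ and $y=(y_1,y_2)\in\mathtt B$, the entries of the inverse matrix $K^{-1}$ are $$K^{-1}(x,y)=\begin{cases} f_1(x,y), & x_1<y_1+1,\\ f_1(x,y)-f_2(x,y), & x_1\ge y_1+1,\end{cases}$$ where $$f_1(x,y)=\frac{(-1)^{(y_1+y_2+x_1+x_2)/4}}{(2\pi i)^2}\int_{\mathcal E_2}\int_{\mathcal E_1}\frac{w^{y_1/2}}{z^{(x_1+1)/2}(w-z)}\,\frac{(a+z)^{x_2/2}(az-1)^{(2n-x_2)/2}}{(aw-1)^{(2n+1-y_2)/2}(a+w)^{(y_2+1)/2}}\,dz\,dw$$ and $$f_2(x,y)=\frac{(-1)^{(x_1+x_2+y_1+y_2)/4}}{2\pi i}\,a^{(y_2-x_2-1)/2}\int_{\mathcal E_1}\frac{z^{(y_2-x_2-1)/2}(1/a+z)^{(y_1-x_1-1)/2}}{(1/a+a+z)^{(y_2-x_2+1)/2}}\,dz .$$ Here $\mathcal E_1$ is the positively oriented circle $|z|=\epsilon$ and $\mathcal E_2$ is the positively oriented circle $|w-1/a|=\epsilon$, where $\epsilon>0$ is such that the two circles do not intersect.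
   Context: The Aztec diamond graph of order $n$ is the bipartite graph with white vertices $\mathtt W=\{(x_1,x_2)\in\mathbb Z^2: x_1 \text{ odd}, x_2\text{ even}, 1\le x_1\le 2n-1, 0\le x_2\le 2n\}$ and black vertices $\mathtt B=\{(x_1,x_2)\in\mathbb Z^2: x_1\text{ even}, x_2\text{ odd}, 0\le x_1\le 2n, 1\le x_2\le 2n-1\}$. Put $e_1=(1,1)$, $e_2=(-1,1)$; $b\in\mathtt B$ and $w\in\mathtt W$ are adjacent iff $w-b\in\{\pm e_1,\pm e_2\}$. The Kasteleyn matrix $K=(K(b,w))_{b\in\mathtt B,w\in\mathtt W}$ (rows indexed by black vertices, columns by white vertices; $|\mathtt B|=|\mathtt W|=n(n+1)$) is, for $b=(b_1,b_2)\in\mathtt B$, $w\in\mathtt W$ and $l\in\{0,1\}$, $$K(b,w)=\begin{cases}(-1)^{l+(b_1+b_2-1)/2}, & w=b+(-1)^l e_1,\\ (-1)^{l+(b_1+b_2-1)/2}\,a\,i, & w=b-(-1)^l e_2,\\ 0,&\text{otherwise.}\end{cases}$$ The inverse $K^{-1}$ has rows indexed by $\mathtt W$ and columns by $\mathtt B$. Convention: for even integers $m$, $(-1)^{m/4}:=i^{m/2}$. All other exponents in the formulas are integers. *)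

theory Defs
  imports "HOL-Complex_Analysis.Complex_Analysis"
begin

definition white_vertices :: "nat \<Rightarrow> (int \<times> int) set" where
  "white_vertices n =
     {(x1, x2). odd x1 \<and> even x2 \<and> 1 \<le> x1 \<and> x1 \<le> 2 * int n - 1 \<and> 0 \<le> x2 \<and> x2 \<le> 2 * int n}"

definition black_vertices :: "nat \<Rightarrow> (int \<times> int) set" where
  "black_vertices n =
     {(x1, x2). even x1 \<and> odd x2 \<and> 0 \<le> x1 \<and> x1 \<le> 2 * int n \<and> 1 \<le> x2 \<and> x2 \<le> 2 * int n - 1}"

definition e1 :: "int \<times> int" where
  "e1 = (1, 1)"

definition e2 :: "int \<times> int" where
  "e2 = (-1, 1)"

text \<open>
  The first two cases are \<open>w = b + (-1)\<^sup>l e1\<close> and the next two are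
  \<open>w = b - (-1)\<^sup>l e2\<close>, each for \<open>l = 0\<close> and \<open>l = 1\<close> in this order. The entries depend on
  the order of the Aztec diamond only through the index sets of rows and columns.
  The exponent \<open>(b1 + b2 - 1) div 2\<close> is exact, since \<open>b1\<close> is even and \<open>b2\<close> is odd.
\<close>

definition kasteleyn :: "real \<Rightarrow> int \<times> int \<Rightarrow> int \<times> int \<Rightarrow> complex" where
  "kasteleyn a b w =
     (let s = (fst b + snd b - 1) div 2 in
      if w = b + e1 then (-1) powi s
      else if w = b - e1 then (-1) powi (1 + s)
      else if w = b - e2 then (-1) powi s * of_real a * \<i>
      else if w = b + e2 then (-1) powi (1 + s) * of_real a * \<i>
      else 0)"

text \<open>
  Matrices with rows indexed by a finite set \<open>R\<close> and columns by a finite set \<open>C\<close>; an inverse has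
  rows indexed by \<open>C\<close> and columns by \<open>R\<close>. The last two definitions follow \<^const>\<open>invertible\<close>
  and \<^const>\<open>matrix_inv\<close>. Only the entries of \<open>inverse_matrix R C M\<close> on \<open>C \<times> R\<close> are meaningful.
\<close>

definition is_inverse_matrix ::
    "'r set \<Rightarrow> 'c set \<Rightarrow> ('r \<Rightarrow> 'c \<Rightarrow> complex) \<Rightarrow> ('c \<Rightarrow> 'r \<Rightarrow> complex) \<Rightarrow> bool" where
  "is_inverse_matrix R C M N \<longleftrightarrow>
     (\<forall>r\<in>R. \<forall>r'\<in>R. (\<Sum>c\<in>C. M r c * N c r') = (if r = r' then 1 else 0)) \<and>
     (\<forall>c\<in>C. \<forall>c'\<in>C. (\<Sum>r\<in>R. N c r * M r c') = (if c = c' then 1 else 0))"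

definition invertible_matrix :: "'r set \<Rightarrow> 'c set \<Rightarrow> ('r \<Rightarrow> 'c \<Rightarrow> complex) \<Rightarrow> bool" where
  "invertible_matrix R C M \<longleftrightarrow> (\<exists>N. is_inverse_matrix R C M N)"

definition inverse_matrix ::
    "'r set \<Rightarrow> 'c set \<Rightarrow> ('r \<Rightarrow> 'c \<Rightarrow> complex) \<Rightarrow> 'c \<Rightarrow> 'r \<Rightarrow> complex" where
  "inverse_matrix R C M = (SOME N. is_inverse_matrix R C M N)"

text \<open>
  The prefactor \<open>(-1)\<^bsup>m/4\<^esup>\<close> with \<open>m = x1 + x2 + y1 + y2\<close> even stands for \<open>\<i>\<^bsup>m/2\<^esup>\<close>.
  All uses of \<open>div 2\<close> below are exact for \<open>x\<close> a white and \<open>y\<close> a black vertex.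
\<close>

definition f1 :: "real \<Rightarrow> nat \<Rightarrow> real \<Rightarrow> int \<times> int \<Rightarrow> int \<times> int \<Rightarrow> complex" where
  "f1 a n \<epsilon> x y =
     (case (x, y) of ((x1, x2), (y1, y2)) \<Rightarrow>
        \<i> powi ((y1 + y2 + x1 + x2) div 2) / (2 * of_real pi * \<i>) ^ 2 *
        contour_integral (circlepath (1 / of_real a) \<epsilon>) (\<lambda>w.
          contour_integral (circlepath 0 \<epsilon>) (\<lambda>z.
            w powi (y1 div 2) / (z powi ((x1 + 1) div 2) * (w - z)) *
            ((of_real a + z) powi (x2 div 2) * (of_real a * z - 1) powi ((2 * int n - x2) div 2) /
             ((of_real a * w - 1) powi ((2 * int n + 1 - y2) div 2) *
              (of_real a + w) powi ((y2 + 1) div 2))))))"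

definition f2 :: "real \<Rightarrow> real \<Rightarrow> int \<times> int \<Rightarrow> int \<times> int \<Rightarrow> complex" where
  "f2 a \<epsilon> x y =
     (case (x, y) of ((x1, x2), (y1, y2)) \<Rightarrow>
        \<i> powi ((x1 + x2 + y1 + y2) div 2) / (2 * of_real pi * \<i>) *
        of_real a powi ((y2 - x2 - 1) div 2) *
        contour_integral (circlepath 0 \<epsilon>) (\<lambda>z.
          z powi ((y2 - x2 - 1) div 2) * (1 / of_real a + z) powi ((y1 - x1 - 1) div 2) /
          (1 / of_real a + of_real a + z) powi ((y2 - x2 + 1) div 2)))"

end

theory Submission
  imports Defs "Jordan_Normal_Form.Determinant"
begin

text \<open>
  Up to a power of \<open>\<i>\<close>, the variable \<open>x\<close> enters both integrals only through the kernel
  \<open>\<Phi>(z) = (a + z)\<^sup>k (a z - 1)\<^bsup>n - k\<^esup> / z\<^sup>p\<close>, where \<open>x = (2p - 1, 2k)\<close>; for \<open>f2\<close> this becomes visible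
  after the substitution \<open>z = w - 1/a\<close>. The combination of the four kernels around a black vertex
  that \<open>K\<close> forms is identically zero, so \<open>K\<close> annihilates \<open>f1\<close>, and it annihilates \<open>f2\<close> except
  where only two of the four neighbours satisfy \<open>x1 \<ge> y1 + 1\<close>, that is in the column of \<open>y\<close>; there
  a one-dimensional residue gives the Kronecker delta. Neighbours outside the diamond contribute
  nothing: for \<open>x1 = -1\<close> the inner integrand of \<open>f1\<close> is holomorphic, and for \<open>x1 = 2n + 1\<close> it is
  \<open>O(z\<^bsup>-2\<^esup>)\<close> at infinity, so the inner integral is given by the residue at \<open>z = w\<close> and \<open>f1 = f2\<close>. Hence the
  formula is a right inverse of the square matrix \<open>K\<close>, and therefore its inverse.
\<close>

section \<open>Inverses of finite matrices with arbitrary index sets\<close>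

text \<open>For square matrices over a field, a right inverse is also a left inverse. An enumeration
  of \<open>R\<close>, carried over to \<open>C\<close> by \<open>h\<close>, turns \<open>M\<close>
  and \<open>N\<close> into matrices of the same numeric dimension, where this fact is
  available.\<close>

lemma is_inverse_matrix_if_right_inverse:
  fixes M :: "'r \<Rightarrow> 'c \<Rightarrow> complex" and N :: "'c \<Rightarrow> 'r \<Rightarrow> complex"
  assumes bij: "bij_betw h R C" and fin: "finite R"
    and MN: "\<And>r r'. r \<in> R \<Longrightarrow> r' \<in> R \<Longrightarrow> (\<Sum>c\<in>C. M r c * N c r') = (if r = r' then 1 else 0)"
  shows "is_inverse_matrix R C M N"
proof -
  define m where "m = card R"
  obtain f where f: "bij_betw f {0..<m} R"
    using fin ex_bij_betw_nat_finite m_def by blast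
  define g where "g = h \<circ> f"
  have g: "bij_betw g {0..<m} C"
    unfolding g_def using bij_betw_trans[OF f bij] .
  define A B where "A = mat m m (\<lambda>(i,j). M (f i) (g j))" and "B = mat m m (\<lambda>(i,j). N (g i) (f j))"
  have carrier: "A \<in> carrier_mat m m" "B \<in> carrier_mat m m"
    by (auto simp: A_def B_def)
  have fR: "f i \<in> R" if "i < m" for i
    using f that by (auto simp: bij_betw_def)
  have f_inj: "f i = f j \<longleftrightarrow> i = j" if "i < m" "j < m" for i j
    using f that by (auto simp: bij_betw_def inj_on_def)
  have g_inj: "g i = g j \<longleftrightarrow> i = j" if "i < m" "j < m" for i j
    using g that by (auto simp: bij_betw_def inj_on_def)
  have "A * B = 1\<^sub>m m"
  proof (rule eq_matI)
    fix i j assume "i < dim_row (1\<^sub>m m :: complex mat)" "j < dim_col (1\<^sub>m m :: complex mat)"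
    then have ij: "i < m" "j < m" by auto
    have "(A * B) $$ (i, j) = (\<Sum>l\<in>{0..<m}. M (f i) (g l) * N (g l) (f j))"
      using ij by (simp add: A_def B_def scalar_prod_def)
    also have "\<dots> = (\<Sum>c\<in>C. M (f i) c * N c (f j))"
      by (rule sum.reindex_bij_betw[OF g])
    finally show "(A * B) $$ (i, j) = 1\<^sub>m m $$ (i, j)"
      using ij by (simp add: MN fR f_inj)
  qed (auto simp: A_def B_def)
  then have BA: "B * A = 1\<^sub>m m"
    using mat_mult_left_right_inverse carrier by blast
  have "(\<Sum>r\<in>R. N c r * M r c') = (if c = c' then 1 else 0)" if "c \<in> C" "c' \<in> C" for c c'
  proof -
    have "C = g ` {0..<m}"
      using g by (simp add: bij_betw_def)
    with that obtain i j where ij: "i < m" "j < m" "c = g i" "c' = g j"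
      by auto
    have "(\<Sum>r\<in>R. N c r * M r c') = (\<Sum>l\<in>{0..<m}. N c (f l) * M (f l) c')"
      by (rule sum.reindex_bij_betw[OF f, symmetric])
    also have "\<dots> = (B * A) $$ (i, j)"
      using ij by (simp add: A_def B_def scalar_prod_def)
    finally show ?thesis
      using ij by (simp add: BA g_inj)
  qed
  with MN show ?thesis
    by (simp add: is_inverse_matrix_def)
qed

text \<open>By associativity, N = N(MN') = (NM)N' = N'. Since \<open>inverse_matrix\<close> is a
  \<open>SOME\<close> choice, this is what fixes its entries on \<open>C\<close> times
  \<open>R\<close>.\<close>

lemma is_inverse_matrix_unique:
  assumes N: "is_inverse_matrix R C M N" and N': "is_inverse_matrix R C M N'"
    and "finite R" "finite C" "c \<in> C" "r \<in> R"
  shows "N c r = N' c r"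
proof -
  have "N c r = (\<Sum>r'\<in>R. N c r' * (\<Sum>c'\<in>C. M r' c' * N' c' r))"
  proof -
    have "(\<Sum>r'\<in>R. N c r' * (\<Sum>c'\<in>C. M r' c' * N' c' r)) = (\<Sum>r'\<in>R. if r' = r then N c r' else 0)"
      using N' \<open>r \<in> R\<close> by (intro sum.cong) (auto simp: is_inverse_matrix_def)
    then show ?thesis using assms by simp
  qed
  also have "\<dots> = (\<Sum>c'\<in>C. (\<Sum>r'\<in>R. N c r' * M r' c') * N' c' r)"
    by (simp add: sum_distrib_left sum_distrib_right mult.assoc) (rule sum.swap)
  also have "\<dots> = (\<Sum>c'\<in>C. (if c = c' then 1 else 0) * N' c' r)"
    using N \<open>c \<in> C\<close> by (intro sum.cong) (auto simp: is_inverse_matrix_def)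
  also have "\<dots> = (\<Sum>c'\<in>C. if c = c' then N' c' r else 0)"
    by (intro sum.cong) auto
  also have "\<dots> = N' c r" using assms by simp
  finally show ?thesis .
qed

section \<open>Cauchy integrals over circles\<close>

text \<open>Off the circle the Cauchy transform is even differentiable, by
  \<open>Cauchy_next_derivative\<close> with exponent 1 and density \<open>- g\<close>, the sign
  coming from the orientation of \<open>w - z\<close>. It makes the outer integrand of the double
  integral continuous, hence integrable.\<close>

lemma continuous_on_cauchy_transform_circlepath:
  fixes g :: "complex \<Rightarrow> complex"
  assumes "continuous_on (sphere c r) g" "r \<ge> 0" "S \<inter> sphere c r = {}"
  shows "continuous_on S (\<lambda>w. contour_integral (circlepath c r) (\<lambda>z. g z / (w - z)))"
proof -
  let ?\<gamma> = "circlepath c r"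
  have im: "path_image ?\<gamma> = sphere c r"
    using assms by simp
  have "((\<lambda>w. contour_integral ?\<gamma> (\<lambda>z. - g z / (z - w) ^ 1)) has_field_derivative
      (of_nat 1 * contour_integral ?\<gamma> (\<lambda>z. - g z / (z - w) ^ Suc 1))) (at w)"
    if w: "w \<in> S" for w
  proof (rule Cauchy_next_derivative(2)[where S = UNIV])
    show "continuous_on (path_image ?\<gamma>) (\<lambda>z. - g z)"
      using assms unfolding im by (intro continuous_intros)
    show "norm (vector_derivative ?\<gamma> (at t)) \<le> 2 * pi * r" for t
      using assms by (simp add: vector_derivative_circlepath norm_mult)
    show "((\<lambda>z. - g z / (z - v) ^ 1) has_contour_integral
        contour_integral ?\<gamma> (\<lambda>z. - g z / (z - v) ^ 1)) ?\<gamma>" if "v \<in> UNIV - path_image ?\<gamma>" for v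
      using that assms unfolding im
      by (intro has_contour_integral_integral contour_integrable_continuous_circlepath)
         (auto simp del: path_image_circlepath simp: im intro!: continuous_intros)
    show "w \<in> UNIV - path_image ?\<gamma>"
      using assms w unfolding im by auto
  qed auto
  then have "continuous_on S (\<lambda>w. contour_integral ?\<gamma> (\<lambda>z. - g z / (z - w) ^ 1))"
    by (intro continuous_at_imp_continuous_on ballI DERIV_isCont) blast
  moreover have "- g z / (z - w) ^ 1 = g z / (w - z)" for z w
    by (simp add: divide_simps) (simp add: algebra_simps)
  ultimately show ?thesis
    by simp
qed

lemma contour_integral_circlepath_shift:
  "contour_integral (circlepath c r) f = contour_integral (circlepath 0 r) (\<lambda>z. f (z + c))"
proof -
  have "circlepath c r = (+) c \<circ> circlepath 0 r"
    by (auto simp: circlepath fun_eq_iff)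
  then show ?thesis
    by (simp add: contour_integral_translate)
qed

text \<open>Up to the nonzero constant \<open>- m * c\<close>, the integrand is the derivative of
  the single-valued function \<open>((c + z) / z) powi m\<close>. As \<open>m\<close> may be
  negative, \<open>r < norm c\<close> is needed to keep \<open>c + z\<close> away from zero on the
  circle.\<close>

lemma has_contour_integral_power_int_ratio:
  fixes c :: complex
  assumes "0 < r" "r < norm c" "m \<noteq> 0"
  shows "((\<lambda>z. (c + z) powi (m - 1) / z powi (m + 1)) has_contour_integral 0) (circlepath 0 r)"
proof -
  have nz: "z \<noteq> 0" "c + z \<noteq> 0" if "z \<in> sphere 0 r" for z
    using that assms by (auto simp: add_eq_0_iff2)
  have "((\<lambda>z. ((c + z) / z) powi m) has_field_derivative
       (- of_int m * c) * ((c + z) powi (m - 1) / z powi (m + 1))) (at z within sphere 0 r)" if "z \<in> sphere 0 r" for z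
  proof -
    have "((\<lambda>z. ((c + z) / z) powi m) has_field_derivative
       ((z - (c + z)) / (z * z)) * (of_int m * ((c + z) / z) powi (m - 1))) (at z within sphere 0 r)"
      using nz[OF that] unfolding has_field_derivative_def
      by (auto intro!: derivative_eq_intros simp: fun_eq_iff field_simps)
    moreover have "((z - (c + z)) / (z * z)) * (of_int m * ((c + z) / z) powi (m - 1)) = (- of_int m * c) * ((c + z) powi (m - 1) / z powi (m + 1))"
      using nz[OF that] by (simp add: power_int_divide_distrib power_int_diff power_int_add field_simps)
    ultimately show ?thesis by simp
  qed
  then have "((\<lambda>z. (- of_int m * c) * ((c + z) powi (m - 1) / z powi (m + 1))) has_contour_integral 0) (circlepath 0 r)"
    using assms by (intro Cauchy_theorem_primitive[where S = "sphere 0 r"]) auto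
  then have "((\<lambda>z. inverse (- of_int m * c) * ((- of_int m * c) * ((c + z) powi (m - 1) / z powi (m + 1)))) has_contour_integral inverse (- of_int m * c) * 0) (circlepath 0 r)"
    by (rule has_contour_integral_lmul)
  moreover have "c \<noteq> 0" using assms by auto
  ultimately show ?thesis using assms by (simp add: field_simps)
qed

lemma has_contour_integral_inverse_power:
  assumes "r > 0"
  shows "((\<lambda>z. 1 / z ^ Suc m) has_contour_integral (if m = 0 then 2 * of_real pi * \<i> else 0)) (circlepath 0 r)"
proof (cases m)
  case 0
  then show ?thesis
    using Cauchy_integral_circlepath_simple[of "\<lambda>_. 1" 0 r 0] assms by simp
next
  case (Suc k)
  have "((\<lambda>z. 1 / z ^ Suc m) has_contour_integral 0) (circlepath 0 r)"
  proof (rule Cauchy_theorem_primitive[where S = "sphere 0 r" and f = "\<lambda>z. - (inverse z ^ m / of_nat m)"])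
    fix z :: complex assume "z \<in> sphere 0 r"
    then have "z \<noteq> 0" using assms by auto
    then have "((\<lambda>z. - (inverse z ^ m / of_nat m)) has_field_derivative
        - (of_nat m * (- (inverse z ^ Suc (Suc 0)) * inverse z ^ (m - Suc 0)) / of_nat m)) (at z within sphere 0 r)"
      by (intro DERIV_minus DERIV_cdivide DERIV_power DERIV_inverse)
    then show "((\<lambda>z. - (inverse z ^ m / of_nat m)) has_field_derivative 1 / z ^ Suc m) (at z within sphere 0 r)"
      using Suc by (simp add: field_simps del: of_nat_Suc)
  qed (use assms in auto)
  then show ?thesis using Suc by simp
qed

lemma has_contour_integral_circlepath_cong:
  assumes "(f has_contour_integral i) (circlepath c r)" "r \<ge> 0"
    and "\<And>z. z \<in> sphere c r \<Longrightarrow> f z = g z" "i = j"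
  shows "(g has_contour_integral j) (circlepath c r)"
  using assms by (auto intro: has_contour_integral_eq)

text \<open>Induction on \<open>m\<close> by the partial fraction 1/(z^(m+1) (w-z)) = (1/w) (1/(z^m
  (w-z)) + 1/z^(m+1)).\<close>

lemma has_contour_integral_exterior_Cauchy_power:
  fixes w :: complex
  assumes "r > 0" "norm w > r" "m > 0"
  shows "((\<lambda>z. 1 / z ^ m / (w - z)) has_contour_integral 2 * of_real pi * \<i> / w ^ m) (circlepath 0 r)"
  using assms(3)
proof (induction m)
  case (Suc m)
  have w: "w \<noteq> 0" using assms by auto
  \<comment> \<open>At \<open>m = 0\<close> there is no pole inside the circle and the integral is
    0, not the value of the general formula. The value for exponent 1 then comes entirely from the
    integral of 1/z.\<close>
  have "((\<lambda>z. 1 / z ^ m / (w - z)) has_contour_integral (if m = 0 then 0 else 2 * of_real pi * \<i> / w ^ m)) (circlepath 0 r)"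
  proof (cases m)
    case 0
    have "(\<lambda>z. 1 / (w - z)) holomorphic_on ball 0 (norm w)"
      by (intro holomorphic_intros) auto
    then have "((\<lambda>z. 1 / (w - z)) has_contour_integral 0) (circlepath 0 r)"
      using assms by (intro Cauchy_theorem_disc_simple) auto
    then show ?thesis using 0 by simp
  next
    case (Suc j)
    then show ?thesis using Suc.IH by simp
  qed
  from has_contour_integral_lmul[OF has_contour_integral_add[OF this has_contour_integral_inverse_power[OF assms(1), of m]], of "1 / w"]
  show ?case
  proof (rule has_contour_integral_circlepath_cong)
    fix z :: complex assume "z \<in> sphere 0 r"
    then have "z \<noteq> 0" "w - z \<noteq> 0" using assms by auto
    then show "1 / w * (1 / z ^ m / (w - z) + 1 / z ^ Suc m) = 1 / z ^ Suc m / (w - z)"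
      using w by (simp add: divide_simps)
  qed (use assms w in auto)
qed simp

text \<open>The condition \<open>k + l < m\<close> makes the integrand O(z^(-2)) at infinity, so the
  integral is -2 pi i times the residue at the exterior point \<open>w\<close>. Instead of a contour
  deformation, the proof removes the linear factors one at a time, by induction on \<open>k\<close>
  and \<open>l\<close>, down to a pure power of \<open>z\<close>.\<close>

lemma has_contour_integral_exterior_Cauchy:
  fixes u v \<beta> w :: complex
  assumes "r > 0" "norm w > r" "k + l < m"
  shows "((\<lambda>z. (u + z) ^ k * (\<beta> * z - v) ^ l / z ^ m / (w - z)) has_contour_integral
     2 * of_real pi * \<i> * ((u + w) ^ k * (\<beta> * w - v) ^ l / w ^ m)) (circlepath 0 r)"
  using assms(3)
proof (induction k arbitrary: m)
  case 0
  then have "l < m" by simp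
  then show ?case
  proof (induction l arbitrary: m)
    case 0
    then show ?case
      using has_contour_integral_exterior_Cauchy_power[OF assms(1,2)] by simp
  next
    case (Suc l)
    \<comment> \<open>The free factor \<open>c\<close> lets one identity serve twice: with
      \<open>1 / (w - z)\<close> for the integrands, and with \<open>2 * of_real pi * \<i>\<close>
      at \<open>z = w\<close> for the values.\<close>
    have split: "\<beta> * (c * ((u + z) ^ 0 * (\<beta> * z - v) ^ l / z ^ m')) - v * (c * ((u + z) ^ 0 * (\<beta> * z - v) ^ l / z ^ Suc m')) =
        c * ((u + z) ^ 0 * (\<beta> * z - v) ^ Suc l / z ^ Suc m')" if "z \<noteq> 0" for c z m'
      using that by (simp add: field_simps)
    obtain m' where m: "m = Suc m'" "l < m'" using Suc.prems by (cases m) auto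
    from has_contour_integral_diff[OF has_contour_integral_lmul[OF Suc.IH[OF m(2)], of \<beta>]
        has_contour_integral_lmul[OF Suc.IH[OF Suc_lessD[OF Suc.prems]], of v]]
    show ?case
    proof (rule has_contour_integral_circlepath_cong, goal_cases)
      case (2 z)
      then have "z \<noteq> 0" using assms by auto
      from split[OF this, of "1 / (w - z)" m'] show ?case by (simp add: m mult_ac)
    next
      case 3
      have "w \<noteq> 0" using assms by auto
      from split[OF this, of "2 * of_real pi * \<i>" m'] show ?case by (simp only: m)
    qed (use assms in simp)
  qed
next
  case (Suc k)
  have split: "c * ((u + z) ^ k * (\<beta> * z - v) ^ l / z ^ m') + u * (c * ((u + z) ^ k * (\<beta> * z - v) ^ l / z ^ Suc m')) =
      c * ((u + z) ^ Suc k * (\<beta> * z - v) ^ l / z ^ Suc m')" if "z \<noteq> 0" for c z m'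
    using that by (simp add: field_simps)
  obtain m' where m: "m = Suc m'" "k + l < m'" using Suc.prems by (cases m) auto
  have "k + l < m" using Suc.prems by simp
  from has_contour_integral_add[OF Suc.IH[OF m(2)] has_contour_integral_lmul[OF Suc.IH[OF this], of u]]
  show ?case
  proof (rule has_contour_integral_circlepath_cong, goal_cases)
    case (2 z)
    then have "z \<noteq> 0" using assms by auto
    from split[OF this, of "1 / (w - z)" m'] show ?case by (simp add: m mult_ac)
  next
    case 3
    have "w \<noteq> 0" using assms by auto
    from split[OF this, of "2 * of_real pi * \<i>" m'] show ?case by (simp only: m)
  qed (use assms in simp)
qed

text \<open>The coefficients 1, 1, c, -c are those of \<open>\<Phi>_recurrence\<close> with c =
  \<alpha>; the lemma carries that relation through each integral sign.\<close>

lemma contour_integral_combination: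
  assumes "g1 contour_integrable_on \<gamma>" "g2 contour_integrable_on \<gamma>"
    "g3 contour_integrable_on \<gamma>" "g4 contour_integrable_on \<gamma>"
    and "\<And>z. z \<in> path_image \<gamma> \<Longrightarrow> g1 z + g2 z + c * g3 z - c * g4 z = 0"
  shows "contour_integral \<gamma> g1 + contour_integral \<gamma> g2 + c * contour_integral \<gamma> g3
           - c * contour_integral \<gamma> g4 = 0"
proof -
  have "((\<lambda>z. g1 z + g2 z + c * g3 z - c * g4 z) has_contour_integral
      (contour_integral \<gamma> g1 + contour_integral \<gamma> g2 + c * contour_integral \<gamma> g3
           - c * contour_integral \<gamma> g4)) \<gamma>"
    using assms(1-4)
    by (intro has_contour_integral_add has_contour_integral_diff has_contour_integral_lmul
        has_contour_integral_integral)
  then have "((\<lambda>z. 0) has_contour_integral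
      (contour_integral \<gamma> g1 + contour_integral \<gamma> g2 + c * contour_integral \<gamma> g3
           - c * contour_integral \<gamma> g4)) \<gamma>"
    by (rule has_contour_integral_eq) (use assms(5) in simp)
  then show ?thesis
    using has_contour_integral_unique has_contour_integral_0 by blast
qed

section \<open>Finiteness of the vertex sets and position of the two circles\<close>

lemma finite_white_vertices: "finite (white_vertices n)"
  by (rule finite_subset[of _ "{1..2 * int n - 1} \<times> {0..2 * int n}"]) (auto simp: white_vertices_def)

lemma finite_black_vertices: "finite (black_vertices n)"
  by (rule finite_subset[of _ "{0..2 * int n} \<times> {1..2 * int n - 1}"]) (auto simp: black_vertices_def)

text \<open>Circles of equal radius cannot be nested, so disjoint ones lie apart. Otherwise they
  would meet above the midpoint of their centres, at real part 1/(2a), which is the point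
  \<open>z\<close> of the proof.\<close>

lemma circles_disjoint_imp_small:
  fixes a \<epsilon> :: real
  assumes "a > 0" "\<epsilon> > 0" "sphere (0 :: complex) \<epsilon> \<inter> sphere (1 / of_real a) \<epsilon> = {}"
  shows "2 * \<epsilon> < 1 / a"
proof (rule ccontr)
  assume "\<not> 2 * \<epsilon> < 1 / a"
  define d where "d = 1 / (2 * a)"
  have d: "0 < d" "d \<le> \<epsilon>" "2 * d = 1 / a"
    using \<open>\<not> 2 * \<epsilon> < 1 / a\<close> assms(1) by (auto simp: d_def)
  define z where "z = Complex d (sqrt (\<epsilon>\<^sup>2 - d\<^sup>2))"
  have "d\<^sup>2 \<le> \<epsilon>\<^sup>2"
    using d by (intro power_mono) auto
  then have "norm z = \<epsilon>" "norm (z - of_real (2 * d)) = \<epsilon>"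
    using assms(2) by (simp_all add: z_def cmod_def)
  then have "z \<in> sphere 0 \<epsilon> \<inter> sphere (1 / of_real a) \<epsilon>"
    unfolding d(3) by (simp add: dist_norm norm_minus_commute)
  with assms(3) show False by blast
qed

section \<open>Kernels and reduced contour integrals\<close>

locale aztec_contours =
  fixes a \<epsilon> :: real and n :: nat
  assumes a_pos: "a > 0" and \<epsilon>_pos: "\<epsilon> > 0" and \<epsilon>_small: "2 * \<epsilon> < 1 / a"
begin

abbreviation "\<alpha> \<equiv> (of_real a :: complex)"
abbreviation "E1 \<equiv> circlepath 0 \<epsilon>"
abbreviation "E2 \<equiv> circlepath (1 / \<alpha>) \<epsilon>"

text \<open>
  The white vertex \<open>(2p - 1, 2k)\<close> corresponds to \<open>\<Phi> p k\<close> and the black vertex \<open>(2r, 2t + 1)\<close>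
  to \<open>H r t\<close>. The values \<open>p = 0\<close> and \<open>p = n + 1\<close> are allowed as well: they are the columns just
  outside the Aztec diamond, where the formula for the inverse turns out to vanish.
\<close>

definition \<Phi> :: "nat \<Rightarrow> nat \<Rightarrow> complex \<Rightarrow> complex" where
  "\<Phi> p k z = (\<alpha> + z) ^ k * (\<alpha> * z - 1) ^ (n - k) / z ^ p"

definition H :: "nat \<Rightarrow> nat \<Rightarrow> complex \<Rightarrow> complex" where
  "H r t w = w ^ r / ((\<alpha> * w - 1) ^ (n - t) * (\<alpha> + w) ^ (t + 1))"

definition G1 :: "nat \<Rightarrow> nat \<Rightarrow> nat \<Rightarrow> nat \<Rightarrow> complex" where
  "G1 p k r t = contour_integral E2 (\<lambda>w. H r t w * contour_integral E1 (\<lambda>z. \<Phi> p k z / (w - z)))"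

text \<open>Up to an explicit factor this is \<open>f2\<close>, before its contour is moved to the
  circle centred at 0.\<close>

definition G2 :: "nat \<Rightarrow> nat \<Rightarrow> nat \<Rightarrow> nat \<Rightarrow> complex" where
  "G2 p k r t = contour_integral E2 (\<lambda>w. \<Phi> p k w * H r t w)"

lemma \<alpha>_nz: "\<alpha> \<noteq> 0"
  using a_pos by simp

lemma sphere_E1: "z \<in> sphere 0 \<epsilon> \<Longrightarrow> z \<noteq> 0"
  using \<epsilon>_pos by auto

text \<open>The circle lies in the right half plane, so \<open>\<alpha> + w\<close> has positive
  real part, while \<alpha> w - 1 is \<alpha> times w - 1/\<alpha>. Thus no pole of \<open>H\<close>
  or \<open>\<Phi>\<close> lies on \<open>E2\<close>, and all of \<open>E2\<close> is outside
  \<open>E1\<close>.\<close>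

lemma sphere_E2:
  assumes "w \<in> sphere (1 / \<alpha>) \<epsilon>"
  shows "w \<noteq> 0" "\<alpha> + w \<noteq> 0" "\<alpha> * w - 1 \<noteq> 0" "norm w > \<epsilon>"
proof -
  define u where "u = w - 1 / \<alpha>"
  have u: "norm u = \<epsilon>" and w: "w = 1 / \<alpha> + u"
    using assms by (auto simp: u_def dist_norm norm_minus_commute)
  have "norm (1 / \<alpha>) = 1 / a" using a_pos by (simp add: norm_divide)
  then show nw: "norm w > \<epsilon>"
    using norm_triangle_ineq4[of w u] \<epsilon>_small u w by simp
  then show "w \<noteq> 0" using \<epsilon>_pos by auto
  have "\<bar>Re u\<bar> \<le> \<epsilon>" using abs_Re_le_cmod[of u] u by simp
  then have "Re (\<alpha> + w) > 0"
    using a_pos \<epsilon>_pos \<epsilon>_small unfolding w by (simp add: Re_divide power2_eq_square)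
  then show "\<alpha> + w \<noteq> 0"
    by (metis less_irrefl zero_complex.sel(1))
  have "\<alpha> * w - 1 = \<alpha> * u"
    using \<alpha>_nz by (simp add: w field_simps)
  then show "\<alpha> * w - 1 \<noteq> 0"
    using \<alpha>_nz u \<epsilon>_pos by auto
qed

text \<open>After the common factor is taken out, a polynomial remains that expands to zero. The
  four terms belong to the neighbours \<open>b + e1\<close>, \<open>b - e1\<close>,
  \<open>b - e2\<close>, \<open>b + e2\<close> of b = (2p, 2q + 1), in this order.\<close>

lemma \<Phi>_recurrence:
  assumes "z \<noteq> 0" "q < n"
  shows "\<Phi> (Suc p) (Suc q) z + \<Phi> p q z + \<alpha> * \<Phi> (Suc p) q z - \<alpha> * \<Phi> p (Suc q) z = 0"
proof -
  obtain l where n: "n = q + Suc l" using \<open>q < n\<close> less_iff_Suc_add[of q n] by auto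
  have "\<Phi> (Suc p) (Suc q) z + \<Phi> p q z + \<alpha> * \<Phi> (Suc p) q z - \<alpha> * \<Phi> p (Suc q) z =
      (\<alpha> + z) ^ q * (\<alpha> * z - 1) ^ l / z ^ Suc p *
        ((\<alpha> + z) + z * (\<alpha> * z - 1) + \<alpha> * (\<alpha> * z - 1) - \<alpha> * z * (\<alpha> + z))"
    using assms(1) unfolding \<Phi>_def by (simp add: n field_simps)
  then show ?thesis by (simp add: algebra_simps)
qed

lemma continuous_on_\<Phi>: "0 \<notin> S \<Longrightarrow> continuous_on S (\<Phi> p k)"
  unfolding \<Phi>_def by (intro continuous_intros) auto

lemma continuous_on_H: "continuous_on (sphere (1 / \<alpha>) \<epsilon>) (H r t)"
  unfolding H_def using sphere_E2 by (intro continuous_intros) auto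

lemma E1_integrable:
  assumes "norm w > \<epsilon>"
  shows "(\<lambda>z. \<Phi> p k z / (w - z)) contour_integrable_on E1"
  using assms \<epsilon>_pos
  by (intro contour_integrable_continuous_circlepath continuous_intros continuous_on_\<Phi>) auto

lemma E2_integrable_G1:
  "(\<lambda>w. H r t w * contour_integral E1 (\<lambda>z. \<Phi> p k z / (w - z))) contour_integrable_on E2"
proof -
  have "continuous_on (sphere (1 / \<alpha>) \<epsilon>)
      (\<lambda>w. H r t w * contour_integral E1 (\<lambda>z. \<Phi> p k z / (w - z)))"
    using \<epsilon>_pos sphere_E2(4)
    by (intro continuous_intros continuous_on_H continuous_on_cauchy_transform_circlepath
        continuous_on_\<Phi>) fastforce+
  then show ?thesis
    using \<epsilon>_pos by (intro contour_integrable_continuous_circlepath) simp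
qed

lemma E2_integrable_G2: "(\<lambda>w. \<Phi> p k w * H r t w) contour_integrable_on E2"
  using \<epsilon>_pos sphere_E2(1)
  by (intro contour_integrable_continuous_circlepath continuous_intros)
     (auto intro!: continuous_on_\<Phi> continuous_on_H simp del: mem_sphere)

section \<open>Recurrences, boundary columns and the jump at the column of \<open>y\<close>\<close>

lemma G1_recurrence:
  assumes "q < n"
  shows "G1 (Suc p) (Suc q) r t + G1 p q r t + \<alpha> * G1 (Suc p) q r t - \<alpha> * G1 p (Suc q) r t = 0"
  unfolding G1_def
proof (rule contour_integral_combination)
  fix w assume "w \<in> path_image E2"
  then have w: "norm w > \<epsilon>" using sphere_E2(4) \<epsilon>_pos by simp
  let ?I = "\<lambda>p k. contour_integral E1 (\<lambda>z. \<Phi> p k z / (w - z))"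
  have "?I (Suc p) (Suc q) + ?I p q + \<alpha> * ?I (Suc p) q - \<alpha> * ?I p (Suc q) = 0"
  proof (rule contour_integral_combination[OF E1_integrable E1_integrable E1_integrable E1_integrable])
    fix z assume "z \<in> path_image E1"
    then have "z \<noteq> 0" using \<epsilon>_pos by auto
    from \<Phi>_recurrence[OF this assms, of p]
    have "(\<Phi> (Suc p) (Suc q) z + \<Phi> p q z + \<alpha> * \<Phi> (Suc p) q z - \<alpha> * \<Phi> p (Suc q) z) / (w - z) = 0"
      by simp
    then show "\<Phi> (Suc p) (Suc q) z / (w - z) + \<Phi> p q z / (w - z)
        + \<alpha> * (\<Phi> (Suc p) q z / (w - z)) - \<alpha> * (\<Phi> p (Suc q) z / (w - z)) = 0"
      by (simp add: add_divide_distrib diff_divide_distrib)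
  qed (use w in auto)
  then have "H r t w * (?I (Suc p) (Suc q) + ?I p q + \<alpha> * ?I (Suc p) q - \<alpha> * ?I p (Suc q)) = 0"
    by simp
  then show "H r t w * ?I (Suc p) (Suc q) + H r t w * ?I p q
      + \<alpha> * (H r t w * ?I (Suc p) q) - \<alpha> * (H r t w * ?I p (Suc q)) = 0"
    by (simp only: algebra_simps)
qed (rule E2_integrable_G1)+

lemma G2_recurrence:
  assumes "q < n"
  shows "G2 (Suc p) (Suc q) r t + G2 p q r t + \<alpha> * G2 (Suc p) q r t - \<alpha> * G2 p (Suc q) r t = 0"
  unfolding G2_def
proof (rule contour_integral_combination)
  fix w assume "w \<in> path_image E2"
  then have "w \<noteq> 0" using sphere_E2(1) \<epsilon>_pos by simp
  from \<Phi>_recurrence[OF this assms, of p]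
  have "(\<Phi> (Suc p) (Suc q) w + \<Phi> p q w + \<alpha> * \<Phi> (Suc p) q w - \<alpha> * \<Phi> p (Suc q) w) * H r t w = 0"
    by simp
  then show "\<Phi> (Suc p) (Suc q) w * H r t w + \<Phi> p q w * H r t w
      + \<alpha> * (\<Phi> (Suc p) q w * H r t w) - \<alpha> * (\<Phi> p (Suc q) w * H r t w) = 0"
    by (simp only: algebra_simps)
qed (rule E2_integrable_G2)+

lemma G1_left_boundary: "G1 0 k r t = 0"
proof -
  have "contour_integral E1 (\<lambda>z. \<Phi> 0 k z / (w - z)) = 0" if "w \<in> sphere (1 / \<alpha>) \<epsilon>" for w
  proof -
    have "(\<lambda>z. \<Phi> 0 k z / (w - z)) holomorphic_on ball 0 (norm w)"
      unfolding \<Phi>_def by (intro holomorphic_intros) auto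
    then have "((\<lambda>z. \<Phi> 0 k z / (w - z)) has_contour_integral 0) E1"
      using sphere_E2(4)[OF that] \<epsilon>_pos by (intro Cauchy_theorem_disc_simple) auto
    then show ?thesis by (rule contour_integral_unique)
  qed
  then have "G1 0 k r t = contour_integral E2 (\<lambda>_. 0)"
    unfolding G1_def using \<epsilon>_pos by (intro contour_integral_eq) simp
  then show ?thesis by simp
qed

text \<open>The numerator of the kernel has degree at most k + (n - k) = n, below the exponent
  \<open>Suc n\<close> of \<open>z\<close>, so \<open>has_contour_integral_exterior_Cauchy\<close>
  evaluates the inner integral.\<close>

lemma G1_right_boundary:
  assumes "k \<le> n"
  shows "G1 (Suc n) k r t = 2 * of_real pi * \<i> * G2 (Suc n) k r t"
proof -
  have *: "contour_integral E1 (\<lambda>z. \<Phi> (Suc n) k z / (w - z)) = 2 * of_real pi * \<i> * \<Phi> (Suc n) k w"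
    if "w \<in> sphere (1 / \<alpha>) \<epsilon>" for w
    unfolding \<Phi>_def using sphere_E2(4)[OF that] assms \<epsilon>_pos
    by (intro contour_integral_unique has_contour_integral_exterior_Cauchy) auto
  have "G1 (Suc n) k r t = contour_integral E2 (\<lambda>w. (2 * of_real pi * \<i>) * (\<Phi> (Suc n) k w * H r t w))"
    unfolding G1_def using \<epsilon>_pos by (intro contour_integral_eq) (simp add: *)
  also have "\<dots> = 2 * of_real pi * \<i> * G2 (Suc n) k r t"
    unfolding G2_def by (intro contour_integral_lmul E2_integrable_G2)
  finally show ?thesis .
qed

text \<open>The combination produces the factor (\<alpha> + w) + \<alpha> (\<alpha> w - 1) = (1 +
  \<alpha>^2) w, and in column \<open>Suc r\<close> this cancels every power of \<open>w\<close>.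
  With z = w - 1/\<alpha> and m = q - t, what remains is a constant times (c + z)^(m-1) /
  z^(m+1).\<close>

lemma G2_diagonal:
  assumes "q < n" "t < n"
  shows "G2 (Suc r) (Suc q) r t + \<alpha> * G2 (Suc r) q r t = (if q = t then 2 * of_real pi * \<i> else 0)"
proof -
  define c where "c = 1 / \<alpha> + \<alpha>"
  define m where "m = int q - int t"
  have c_\<alpha>: "1 + \<alpha>\<^sup>2 = c * \<alpha>"
    using \<alpha>_nz by (simp add: c_def field_simps power2_eq_square)
  have c_eq: "c = of_real (1 / a + a)" by (simp add: c_def)
  then have "norm c = 1 / a + a" using a_pos by (simp only: norm_of_real) simp
  then have norm_c: "\<epsilon> < norm c" using \<epsilon>_small \<epsilon>_pos a_pos by simp
  have c_nz: "c \<noteq> 0" using norm_c \<epsilon>_pos by auto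
  \<comment> \<open>For m = 0 the integrand 1/((c + z) z) has residue 1/c at 0; for any other
    \<open>m\<close> it has a primitive on the circle.\<close>
  have "((\<lambda>z. (c + z) powi (m - 1) / z powi (m + 1)) has_contour_integral
      (if q = t then 2 * of_real pi * \<i> / c else 0)) E1"
  proof (cases "q = t")
    case True
    have "(\<lambda>z. 1 / (c + z)) holomorphic_on cball 0 \<epsilon>"
      using norm_c by (intro holomorphic_intros) (auto simp: add_eq_0_iff2)
    from Cauchy_integral_circlepath_simple[OF this, of 0] show ?thesis
      using \<epsilon>_pos True by (simp add: m_def power_int_minus field_simps)
  next
    case False
    then show ?thesis
      using has_contour_integral_power_int_ratio[OF \<epsilon>_pos norm_c, of m] by (simp add: m_def)
  qed
  from has_contour_integral_lmul[OF this, of "(1 + \<alpha>\<^sup>2) * \<alpha> powi (- m - 1)"]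
  have shifted: "((\<lambda>z. (1 + \<alpha>\<^sup>2) * \<alpha> powi (- m - 1) * ((c + z) powi (m - 1) / z powi (m + 1)))
      has_contour_integral (if q = t then 2 * of_real pi * \<i> else 0)) E1"
  proof (rule has_contour_integral_circlepath_cong)
    show "(1 + \<alpha>\<^sup>2) * \<alpha> powi (- m - 1) * (if q = t then 2 * of_real pi * \<i> / c else 0) =
        (if q = t then 2 * of_real pi * \<i> else 0)"
      unfolding c_\<alpha> using c_nz \<alpha>_nz by (simp add: m_def power_int_minus)
  qed (use \<epsilon>_pos in auto)
  have eq: "\<Phi> (Suc r) (Suc q) w * H r t w + \<alpha> * (\<Phi> (Suc r) q w * H r t w) =
      (1 + \<alpha>\<^sup>2) * \<alpha> powi (- m - 1) * ((c + (w - 1 / \<alpha>)) powi (m - 1) / (w - 1 / \<alpha>) powi (m + 1))"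
    if "w \<in> sphere (1 / \<alpha>) \<epsilon>" for w
  proof -
    note nz = sphere_E2[OF that]
    define l where "l = n - Suc q"
    then have l: "n - Suc q = l" "n - q = Suc l" using \<open>q < n\<close> by auto
    have "\<Phi> (Suc r) (Suc q) w * H r t w + \<alpha> * (\<Phi> (Suc r) q w * H r t w) =
        ((\<alpha> + w) + \<alpha> * (\<alpha> * w - 1)) / w *
        ((\<alpha> + w) ^ q * (\<alpha> * w - 1) ^ l / ((\<alpha> * w - 1) ^ (n - t) * (\<alpha> + w) ^ (t + 1)))"
    proof -
      define Y where "Y = (\<alpha> + w) ^ q * (\<alpha> * w - 1) ^ l / w ^ Suc r"
      have \<Phi>: "\<Phi> (Suc r) (Suc q) w = (\<alpha> + w) * Y" "\<Phi> (Suc r) q w = (\<alpha> * w - 1) * Y"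
        by (simp_all add: \<Phi>_def Y_def l)
      have "Y * H r t w =
          (\<alpha> + w) ^ q * (\<alpha> * w - 1) ^ l / ((\<alpha> * w - 1) ^ (n - t) * (\<alpha> + w) ^ (t + 1)) / w"
        using nz(1) by (simp add: Y_def H_def)
      moreover have "\<Phi> (Suc r) (Suc q) w * H r t w + \<alpha> * (\<Phi> (Suc r) q w * H r t w) =
          ((\<alpha> + w) + \<alpha> * (\<alpha> * w - 1)) * (Y * H r t w)"
        unfolding \<Phi> by (simp only: algebra_simps)
      ultimately show ?thesis by simp
    qed
    also have "((\<alpha> + w) + \<alpha> * (\<alpha> * w - 1)) / w = 1 + \<alpha>\<^sup>2"
      using nz by (simp add: field_simps power2_eq_square)
    also have "(\<alpha> + w) ^ q * (\<alpha> * w - 1) ^ l / ((\<alpha> * w - 1) ^ (n - t) * (\<alpha> + w) ^ (t + 1)) =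
        (\<alpha> + w) powi (int q - int (t + 1)) * (\<alpha> * w - 1) powi (int l - int (n - t))"
      using nz by (simp add: power_int_diff del: of_nat_Suc of_nat_add)
    also have "int q - int (t + 1) = m - 1" by (simp add: m_def)
    also have "int l - int (n - t) = - m - 1" using assms by (simp add: m_def l_def of_nat_diff)
    also have "\<alpha> + w = c + (w - 1 / \<alpha>)" by (simp add: c_def)
    also have "\<alpha> * w - 1 = \<alpha> * (w - 1 / \<alpha>)" using \<alpha>_nz by (simp add: field_simps)
    also have "(\<alpha> * (w - 1 / \<alpha>)) powi (- m - 1) = \<alpha> powi (- m - 1) / (w - 1 / \<alpha>) powi (m + 1)"
    proof -
      have "- m - 1 = - (m + 1)" by simp
      then show ?thesis
        by (simp only: power_int_mult_distrib power_int_minus divide_inverse inverse_mult_distrib)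
    qed
    finally show ?thesis by simp
  qed
  have "G2 (Suc r) (Suc q) r t + \<alpha> * G2 (Suc r) q r t =
      contour_integral E2 (\<lambda>w. \<Phi> (Suc r) (Suc q) w * H r t w + \<alpha> * (\<Phi> (Suc r) q w * H r t w))"
    unfolding G2_def
    by (intro contour_integral_unique[symmetric] has_contour_integral_add has_contour_integral_lmul
        has_contour_integral_integral E2_integrable_G2)
  also have "\<dots> = contour_integral E2
      (\<lambda>w. (1 + \<alpha>\<^sup>2) * \<alpha> powi (- m - 1) * ((c + (w - 1 / \<alpha>)) powi (m - 1) / (w - 1 / \<alpha>) powi (m + 1)))"
    using \<epsilon>_pos by (intro contour_integral_eq eq) simp
  also have "\<dots> = (if q = t then 2 * of_real pi * \<i> else 0)"
    using contour_integral_unique[OF shifted] by (simp add: contour_integral_circlepath_shift[of "1 / \<alpha>"])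
  finally show ?thesis .
qed

section \<open>The integrals of the theorem in terms of \<open>G1\<close> and
  \<open>G2\<close>\<close>

lemma f1_eq_G1:
  assumes "k \<le> n" "t < n"
  shows "f1 a n \<epsilon> (2 * int p - 1, 2 * int k) (2 * int r, 2 * int t + 1) =
    \<i> ^ (p + k + r + t) / (2 * of_real pi * \<i>) ^ 2 * G1 p k r t"
proof -
  \<comment> \<open>In these coordinates each halving is exact and each exponent is a natural
    number, so \<open>powi\<close> becomes an ordinary power.\<close>
  have e: "(2 * int r + (2 * int t + 1) + (2 * int p - 1) + 2 * int k) div 2 = int (p + k + r + t)"
    "(2 * int p - 1 + 1) div 2 = int p" "2 * int k div 2 = int k" "2 * int r div 2 = int r"
    "(2 * int n - 2 * int k) div 2 = int (n - k)"
    "(2 * int n + 1 - (2 * int t + 1)) div 2 = int (n - t)" "(2 * int t + 1 + 1) div 2 = int (t + 1)"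
    using assms by (simp_all add: of_nat_diff)
  have "contour_integral E1 (\<lambda>z. w ^ r / (z ^ p * (w - z)) *
        ((\<alpha> + z) ^ k * (\<alpha> * z - 1) ^ (n - k) / ((\<alpha> * w - 1) ^ (n - t) * (\<alpha> + w) ^ (t + 1)))) =
      H r t w * contour_integral E1 (\<lambda>z. \<Phi> p k z / (w - z))"
    if "w \<in> sphere (1 / \<alpha>) \<epsilon>" for w
  proof -
    have "contour_integral E1 (\<lambda>z. w ^ r / (z ^ p * (w - z)) *
        ((\<alpha> + z) ^ k * (\<alpha> * z - 1) ^ (n - k) / ((\<alpha> * w - 1) ^ (n - t) * (\<alpha> + w) ^ (t + 1)))) =
      contour_integral E1 (\<lambda>z. H r t w * (\<Phi> p k z / (w - z)))"
      by (intro contour_integral_eq) (simp add: H_def \<Phi>_def mult_ac)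
    also have "\<dots> = H r t w * contour_integral E1 (\<lambda>z. \<Phi> p k z / (w - z))"
      using sphere_E2(4)[OF that] by (intro contour_integral_lmul E1_integrable)
    finally show ?thesis .
  qed
  then have "contour_integral E2 (\<lambda>w. contour_integral E1 (\<lambda>z. w ^ r / (z ^ p * (w - z)) *
        ((\<alpha> + z) ^ k * (\<alpha> * z - 1) ^ (n - k) / ((\<alpha> * w - 1) ^ (n - t) * (\<alpha> + w) ^ (t + 1))))) =
      G1 p k r t"
    unfolding G1_def using \<epsilon>_pos by (intro contour_integral_eq) simp
  then show ?thesis
    unfolding f1_def prod.case e power_int_of_nat by simp
qed

text \<open>The shift w = z + 1/\<alpha> turns \<alpha> w - 1 into \<alpha> z and \<alpha> + w into
  1/\<alpha> + \<alpha> + z. The factor \<alpha>^m split off from (\<alpha> z)^m is the power of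
  \<open>a\<close> in front of the integral in \<open>f2\<close>.\<close>

lemma f2_eq_G2:
  assumes "k \<le> n" "t < n"
  shows "f2 a \<epsilon> (2 * int p - 1, 2 * int k) (2 * int r, 2 * int t + 1) =
    \<i> ^ (p + k + r + t) / (2 * of_real pi * \<i>) * G2 p k r t"
proof -
  define m where "m = int t - int k"
  have e: "(2 * int p - 1 + 2 * int k + 2 * int r + (2 * int t + 1)) div 2 = int (p + k + r + t)"
    "(2 * int t + 1 - 2 * int k - 1) div 2 = m" "(2 * int t + 1 - 2 * int k + 1) div 2 = m + 1"
    "(2 * int r - (2 * int p - 1) - 1) div 2 = int r - int p"
    by (simp_all add: m_def)
  have eq: "\<Phi> p k (z + 1 / \<alpha>) * H r t (z + 1 / \<alpha>) = \<alpha> powi m *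
      (z powi m * (1 / \<alpha> + z) powi (int r - int p) / (1 / \<alpha> + \<alpha> + z) powi (m + 1))"
    if "z \<in> sphere 0 \<epsilon>" for z
  proof -
    define w where "w = z + 1 / \<alpha>"
    have "w \<in> sphere (1 / \<alpha>) \<epsilon>" using that by (simp add: w_def dist_norm)
    note nz = sphere_E2[OF this]
    have "\<Phi> p k w * H r t w = (w ^ r / w ^ p) * ((\<alpha> + w) ^ k / (\<alpha> + w) ^ (t + 1)) *
        ((\<alpha> * w - 1) ^ (n - k) / (\<alpha> * w - 1) ^ (n - t))"
      by (simp add: \<Phi>_def H_def mult_ac)
    also have "\<dots> = w powi (int r - int p) * (\<alpha> + w) powi (int k - int (t + 1)) *
        (\<alpha> * w - 1) powi (int (n - k) - int (n - t))"
      using nz by (simp add: power_int_diff del: of_nat_Suc of_nat_add)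
    also have "int (n - k) - int (n - t) = m" using assms by (simp add: m_def of_nat_diff)
    also have "int k - int (t + 1) = - (m + 1)" by (simp add: m_def)
    also have "\<alpha> * w - 1 = \<alpha> * z" using \<alpha>_nz by (simp add: w_def field_simps)
    finally show ?thesis
      unfolding power_int_minus by (simp add: w_def power_int_mult_distrib divide_inverse algebra_simps)
  qed
  have nz: "z \<noteq> 0" "1 / \<alpha> + z \<noteq> 0" "1 / \<alpha> + \<alpha> + z \<noteq> 0" if "z \<in> sphere 0 \<epsilon>" for z
    using sphere_E2[of "z + 1 / \<alpha>"] sphere_E1 that by (auto simp: dist_norm add_ac)
  have "G2 p k r t = contour_integral E1 (\<lambda>z. \<Phi> p k (z + 1 / \<alpha>) * H r t (z + 1 / \<alpha>))"
    unfolding G2_def by (rule contour_integral_circlepath_shift)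
  also have "\<dots> = contour_integral E1 (\<lambda>z. \<alpha> powi m *
      (z powi m * (1 / \<alpha> + z) powi (int r - int p) / (1 / \<alpha> + \<alpha> + z) powi (m + 1)))"
    using \<epsilon>_pos by (intro contour_integral_eq eq) simp
  also have "\<dots> = \<alpha> powi m * contour_integral E1 (\<lambda>z.
      z powi m * (1 / \<alpha> + z) powi (int r - int p) / (1 / \<alpha> + \<alpha> + z) powi (m + 1))"
    using \<epsilon>_pos nz
    by (intro contour_integral_lmul contour_integrable_continuous_circlepath continuous_intros) auto
  finally show ?thesis
    unfolding f2_def prod.case e power_int_of_nat by simp
qed

section \<open>The right inverse of the Kasteleyn matrix\<close>

text \<open>The claimed inverse, defined on all integer pairs so that it can also be evaluated in
  the columns just outside the diamond.\<close>

definition F :: "int \<times> int \<Rightarrow> int \<times> int \<Rightarrow> complex" where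
  "F x y = (if fst x < fst y + 1 then f1 a n \<epsilon> x y else f1 a n \<epsilon> x y - f2 a \<epsilon> x y)"

lemma F_eq:
  assumes "k \<le> n" "t < n"
  shows "F (2 * int p - 1, 2 * int k) (2 * int r, 2 * int t + 1) =
    \<i> ^ (p + k + r + t) * (G1 p k r t / (2 * of_real pi * \<i>) ^ 2
      - (if r < p then G2 p k r t / (2 * of_real pi * \<i>) else 0))"
  using f1_eq_G1[OF assms, of p r] f2_eq_G2[OF assms, of p r] by (auto simp: F_def algebra_simps)

text \<open>Column -1 falls under the first case, where \<open>G1\<close> vanishes. Column 2n + 1
  falls under the second because r < n + 1, and there the two terms cancel. This permits summing
  over all four neighbours of a black vertex, inside the diamond or not.\<close>

lemma F_boundary:
  assumes "k \<le> n" "t < n" "r \<le> n"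
  shows "F (- 1, 2 * int k) (2 * int r, 2 * int t + 1) = 0"
    and "F (2 * int n + 1, 2 * int k) (2 * int r, 2 * int t + 1) = 0"
  using F_eq[OF assms(1,2), of 0 r] F_eq[OF assms(1,2), of "Suc n" r] assms
  by (simp_all add: G1_left_boundary G1_right_boundary[OF assms(1)] power2_eq_square algebra_simps)

lemma kasteleyn_F_sum:
  fixes p q r t :: nat
  assumes "q < n" "t < n"
  defines "y \<equiv> (2 * int r, 2 * int t + 1)"
  shows "(- 1) ^ (p + q) * (F (2 * int p + 1, 2 * int q + 2) y - F (2 * int p - 1, 2 * int q) y
      + \<alpha> * \<i> * F (2 * int p + 1, 2 * int q) y - \<alpha> * \<i> * F (2 * int p - 1, 2 * int q + 2) y) =
    (if p = r \<and> q = t then 1 else 0)"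
proof -
  define g1 g2 where "g1 = (\<lambda>p k. G1 p k r t / (2 * of_real pi * \<i>) ^ 2)"
    and "g2 = (\<lambda>p k. G2 p k r t / (2 * of_real pi * \<i>))"
  define g where "g = (\<lambda>p k. g1 p k - (if r < p then g2 p k else 0))"
  define c :: complex where "c = \<i> ^ (p + q + r + t)"
  have F_g: "F (2 * int p' - 1, 2 * int k) y = \<i> ^ (p' + k + r + t) * g p' k" if "k \<le> n" for p' k
    unfolding g_def g1_def g2_def y_def by (rule F_eq[OF that assms(2)])
  \<comment> \<open>Each unit step in \<open>p\<close> or \<open>q\<close> contributes a factor
    \<open>\<i>\<close>. This turns the signs of the Kasteleyn matrix into the coefficients 1, 1,
    \<alpha>, -\<alpha> of the recurrences, up to the common factor \<open>- c\<close>.\<close>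
  have F: "F (2 * int p + 1, 2 * int q + 2) y = c * - g (Suc p) (Suc q)"
    "F (2 * int p - 1, 2 * int q) y = c * g p q"
    "F (2 * int p + 1, 2 * int q) y = c * \<i> * g (Suc p) q"
    "F (2 * int p - 1, 2 * int q + 2) y = c * \<i> * g p (Suc q)"
    using F_g[of "Suc q" "Suc p"] F_g[of q p] F_g[of q "Suc p"] F_g[of "Suc q" p] assms(1)
    by (simp_all add: c_def add_ac)
  have "g (Suc p) (Suc q) + g p q + \<alpha> * g (Suc p) q - \<alpha> * g p (Suc q) = (if p = r \<and> q = t then - 1 else 0)"
  proof -
    have "g1 (Suc p) (Suc q) + g1 p q + \<alpha> * g1 (Suc p) q - \<alpha> * g1 p (Suc q) =
        (G1 (Suc p) (Suc q) r t + G1 p q r t + \<alpha> * G1 (Suc p) q r t - \<alpha> * G1 p (Suc q) r t) / (2 * of_real pi * \<i>) ^ 2"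
      by (simp add: g1_def add_divide_distrib diff_divide_distrib)
    then have g1: "g1 (Suc p) (Suc q) + g1 p q + \<alpha> * g1 (Suc p) q - \<alpha> * g1 p (Suc q) = 0"
      by (simp add: G1_recurrence[OF assms(1)])
    have "g2 (Suc p) (Suc q) + g2 p q + \<alpha> * g2 (Suc p) q - \<alpha> * g2 p (Suc q) =
        (G2 (Suc p) (Suc q) r t + G2 p q r t + \<alpha> * G2 (Suc p) q r t - \<alpha> * G2 p (Suc q) r t) / (2 * of_real pi * \<i>)"
      by (simp add: g2_def add_divide_distrib diff_divide_distrib)
    then have g2: "g2 (Suc p) (Suc q) + g2 p q + \<alpha> * g2 (Suc p) q - \<alpha> * g2 p (Suc q) = 0"
      by (simp add: G2_recurrence[OF assms(1)])
    have "g2 (Suc r) (Suc q) + \<alpha> * g2 (Suc r) q =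
        (G2 (Suc r) (Suc q) r t + \<alpha> * G2 (Suc r) q r t) / (2 * of_real pi * \<i>)"
      by (simp add: g2_def add_divide_distrib)
    then have jump: "g2 (Suc r) (Suc q) + \<alpha> * g2 (Suc r) q = (if q = t then 1 else 0)"
      by (simp add: G2_diagonal[OF assms(1,2)])
    \<comment> \<open>The \<open>g2\<close> term is present for none of the four neighbours, for the
      two in column \<open>Suc p\<close> only, or for all four. Only the middle case leaves a
      contribution, namely minus the jump.\<close>
    consider "p < r" | "p = r" | "r < p" by linarith
    then show ?thesis
    proof cases
      case 1
      with g1 show ?thesis by (simp add: g_def)
    next
      case 2
      then have "g (Suc p) (Suc q) + g p q + \<alpha> * g (Suc p) q - \<alpha> * g p (Suc q) =
          (g1 (Suc p) (Suc q) + g1 p q + \<alpha> * g1 (Suc p) q - \<alpha> * g1 p (Suc q))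
          - (g2 (Suc r) (Suc q) + \<alpha> * g2 (Suc r) q)"
        by (simp add: g_def algebra_simps)
      with 2 show ?thesis unfolding g1 jump by simp
    next
      case 3
      then have "g (Suc p) (Suc q) + g p q + \<alpha> * g (Suc p) q - \<alpha> * g p (Suc q) =
          (g1 (Suc p) (Suc q) + g1 p q + \<alpha> * g1 (Suc p) q - \<alpha> * g1 p (Suc q))
          - (g2 (Suc p) (Suc q) + g2 p q + \<alpha> * g2 (Suc p) q - \<alpha> * g2 p (Suc q))"
        by (simp add: g_def algebra_simps)
      with 3 show ?thesis unfolding g1 g2 by simp
    qed
  qed
  \<comment> \<open>On the diagonal \<open>c\<close> is i^(2(p+q)), the same sign as its
    cofactor.\<close>
  moreover have "(- 1) ^ (p + q) * c = 1" if "p = r" "q = t"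
  proof -
    have "c = (\<i> ^ 2) ^ (p + q)"
      unfolding c_def power_mult[symmetric] by (simp add: that mult_2 add_ac)
    then show ?thesis by (simp flip: power_mult_distrib)
  qed
  moreover have "F (2 * int p + 1, 2 * int q + 2) y - F (2 * int p - 1, 2 * int q) y
      + \<alpha> * \<i> * F (2 * int p + 1, 2 * int q) y - \<alpha> * \<i> * F (2 * int p - 1, 2 * int q + 2) y =
      - c * (g (Suc p) (Suc q) + g p q + \<alpha> * g (Suc p) q - \<alpha> * g p (Suc q))"
    unfolding F by (simp add: algebra_simps)
  ultimately show ?thesis by simp
qed

lemma kasteleyn_F:
  assumes "b \<in> black_vertices n" "y \<in> black_vertices n"
  shows "(\<Sum>w\<in>white_vertices n. kasteleyn a b w * F w y) = (if b = y then 1 else 0)"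
proof -
  have vertex: "\<exists>p q. p \<le> n \<and> q < n \<and> v = (2 * int p, 2 * int q + 1)" if "v \<in> black_vertices n" for v
  proof -
    obtain v1 v2 where "v = (v1, v2)" by (cases v)
    with that have "v = (v1, v2)" "even v1" "odd v2" "0 \<le> v1" "v1 \<le> 2 * int n" "1 \<le> v2" "v2 \<le> 2 * int n - 1"
      by (simp_all add: black_vertices_def)
    then show ?thesis
      by (intro exI[of _ "nat (v1 div 2)"] exI[of _ "nat (v2 div 2)"]) auto
  qed
  obtain p q where b: "p \<le> n" "q < n" "b = (2 * int p, 2 * int q + 1)"
    using vertex[OF assms(1)] by blast
  obtain r t where y: "r \<le> n" "t < n" "y = (2 * int r, 2 * int t + 1)"
    using vertex[OF assms(2)] by blast
  define N where "N = {b + e1, b - e1, b - e2, b + e2}"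
  have N: "N = {(2 * int p + 1, 2 * int q + 2), (2 * int p - 1, 2 * int q),
      (2 * int p + 1, 2 * int q), (2 * int p - 1, 2 * int q + 2)}"
    by (simp add: N_def b e1_def e2_def add_ac)
  have "(\<Sum>w\<in>white_vertices n. kasteleyn a b w * F w y) =
      (\<Sum>w\<in>white_vertices n \<inter> N. kasteleyn a b w * F w y)"
    by (intro sum.mono_neutral_right) (auto simp: finite_white_vertices N_def kasteleyn_def Let_def)
  also have "\<dots> = (\<Sum>w\<in>N. kasteleyn a b w * F w y)"
  proof (intro sum.mono_neutral_left ballI)
    fix w assume w: "w \<in> N - white_vertices n \<inter> N"
    have "F w y = 0"
    proof -
      \<comment> \<open>The second coordinate of a neighbour stays in range because q < n. Only the
        column can leave the diamond, which happens on the left for p = 0 and on the right for p =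
        n.\<close>
      obtain k where k: "k \<le> n" "w = (2 * int p + 1, 2 * int k) \<or> w = (2 * int p - 1, 2 * int k)"
        using w b by (auto simp: N intro: that[of q] that[of "Suc q"])
      then have "w = (2 * int n + 1, 2 * int k) \<or> w = (- 1, 2 * int k)"
        using w b by (cases "p = 0"; cases "p = n") (auto simp: white_vertices_def)
      then show ?thesis
        using F_boundary[OF k(1) y(2,1)] y(3) by auto
    qed
    then show "kasteleyn a b w * F w y = 0" by simp
  qed (auto simp: N)
  also have "\<dots> = (- 1) ^ (p + q) * (F (2 * int p + 1, 2 * int q + 2) y - F (2 * int p - 1, 2 * int q) y
      + \<alpha> * \<i> * F (2 * int p + 1, 2 * int q) y - \<alpha> * \<i> * F (2 * int p - 1, 2 * int q + 2) y)"
  proof -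
    have sign: "(- 1 :: complex) powi (int p + int q) = (- 1) ^ (p + q)"
      by (simp only: of_nat_add[symmetric] power_int_of_nat)
    have sign': "(- 1 :: complex) powi (1 + (int p + int q)) = - ((- 1) ^ (p + q))"
      by (subst power_int_add) (simp_all add: sign)
    have "kasteleyn a b (2 * int p + 1, 2 * int q + 2) = (- 1) ^ (p + q)"
      "kasteleyn a b (2 * int p - 1, 2 * int q) = - ((- 1) ^ (p + q))"
      "kasteleyn a b (2 * int p + 1, 2 * int q) = (- 1) ^ (p + q) * \<alpha> * \<i>"
      "kasteleyn a b (2 * int p - 1, 2 * int q + 2) = - ((- 1) ^ (p + q)) * \<alpha> * \<i>"
      unfolding kasteleyn_def Let_def by (simp_all add: b e1_def e2_def sign sign')
    then show ?thesis
      unfolding N by (simp add: algebra_simps)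
  qed
  also have "\<dots> = (if b = y then 1 else 0)"
    unfolding y(3) kasteleyn_F_sum[OF b(2) y(2)] using b(3) by simp
  finally show ?thesis .
qed

end

section \<open>The inverse Kasteleyn matrix\<close>

theorem theorem2p3:
  fixes a \<epsilon> :: real and n :: nat
  assumes "a > 0" and "n \<ge> 1"
    and "\<epsilon> > 0" and "sphere (0 :: complex) \<epsilon> \<inter> sphere (1 / of_real a) \<epsilon> = {}"
  shows "invertible_matrix (black_vertices n) (white_vertices n) (kasteleyn a) \<and>
    (\<forall>x \<in> white_vertices n. \<forall>y \<in> black_vertices n.
       inverse_matrix (black_vertices n) (white_vertices n) (kasteleyn a) x y =
         (if fst x < fst y + 1 then f1 a n \<epsilon> x y else f1 a n \<epsilon> x y - f2 a \<epsilon> x y))"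
proof -
  interpret aztec_contours a \<epsilon> n
  proof
    show "2 * \<epsilon> < 1 / a"
      using circles_disjoint_imp_small[OF assms(1,3,4)] .
  qed (use assms in auto)
  have F: "is_inverse_matrix (black_vertices n) (white_vertices n) (kasteleyn a) F"
  proof (rule is_inverse_matrix_if_right_inverse)
    \<comment> \<open>Reflection in the diagonal exchanges the two colours, so the matrix is
      square.\<close>
    show "bij_betw prod.swap (black_vertices n) (white_vertices n)"
      by (rule bij_betw_byWitness[where f' = prod.swap])
        (auto simp: black_vertices_def white_vertices_def)
  qed (simp_all add: finite_black_vertices kasteleyn_F)
  \<comment> \<open>Existence of the inverse \<open>F\<close> makes the \<open>SOME\<close> choice
    an inverse as well; uniqueness then identifies the two entrywise.\<close>
  moreover from F have "is_inverse_matrix (black_vertices n) (white_vertices n) (kasteleyn a)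
      (inverse_matrix (black_vertices n) (white_vertices n) (kasteleyn a))"
    unfolding inverse_matrix_def by (rule someI[where P = "is_inverse_matrix _ _ _"])
  ultimately have "inverse_matrix (black_vertices n) (white_vertices n) (kasteleyn a) x y = F x y"
    if "x \<in> white_vertices n" "y \<in> black_vertices n" for x y
    using that by (intro is_inverse_matrix_unique) (auto simp: finite_black_vertices finite_white_vertices)
  with F show ?thesis
    by (auto simp: invertible_matrix_def F_def)
qed

end
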